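(* Let $\mathbb{F}$ be a field of characteristic different from $2$, and let $b$ be a symplectic form on a finite-dimensional vector space $V$ over $\mathbb{F}$. Then every $b$-skew-selfadjoint endomorphism $u$ of $V$ is the sum of two square-zero $b$-skew-selfadjoint endomorphisms; i.e. there exist $b$-skew-selfadjoint endomorphisms $a_1,a_2$ of $V$ with $a_1^2=a_2^2=0$ and $u=a_1+a_2$.
   Context: A symplectic form is a non-degenerate alternating bilinear form ($b(x,x)=0$ for all $x$). An endomorphism $u$ of $V$ is $b$-skew-selfadjoint if $b(u(x),y)=-b(x,u(y))$ for all $x,y\in V$. *)

theory Defs
  imports "HOL-Computational_Algebra.Computational_Algebra"
begin

text \<open>
  The vector space is a whole type \<open>'v\<close> with scalar multiplication \<open>scale\<close>; the field
  acts on itself by \<^term>\<open>(*)\<close>. The constant \<^const>\<open>Vector_Spaces.linear\<close> is qualified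
  because \<open>Real_Vector_Spaces\<close> shadows the short name by the notion for real vector spaces.
\<close>

definition bilinear_form ::
  "('f::field \<Rightarrow> 'v::ab_group_add \<Rightarrow> 'v) \<Rightarrow> ('v \<Rightarrow> 'v \<Rightarrow> 'f) \<Rightarrow> bool" where
  "bilinear_form scale b \<longleftrightarrow>
     (\<forall>x. Vector_Spaces.linear scale (*) (\<lambda>y. b x y)) \<and>
     (\<forall>y. Vector_Spaces.linear scale (*) (\<lambda>x. b x y))"

definition alternating_form :: "('v \<Rightarrow> 'v \<Rightarrow> 'f::field) \<Rightarrow> bool" where
  "alternating_form b \<longleftrightarrow> (\<forall>x. b x x = 0)"

text \<open>
  Only the left radical is required to vanish; for an alternating bilinear form, being
  antisymmetric, the left and right radicals coincide.
\<close>

definition nondegenerate_form :: "('v::ab_group_add \<Rightarrow> 'v \<Rightarrow> 'f::field) \<Rightarrow> bool" where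
  "nondegenerate_form b \<longleftrightarrow> (\<forall>x. (\<forall>y. b x y = 0) \<longrightarrow> x = 0)"

definition symplectic_form ::
  "('f::field \<Rightarrow> 'v::ab_group_add \<Rightarrow> 'v) \<Rightarrow> ('v \<Rightarrow> 'v \<Rightarrow> 'f) \<Rightarrow> bool" where
  "symplectic_form scale b \<longleftrightarrow>
     bilinear_form scale b \<and> alternating_form b \<and> nondegenerate_form b"

definition skew_selfadjoint ::
  "('f::field \<Rightarrow> 'v::ab_group_add \<Rightarrow> 'v) \<Rightarrow> ('v \<Rightarrow> 'v \<Rightarrow> 'f) \<Rightarrow> ('v \<Rightarrow> 'v) \<Rightarrow> bool" where
  "skew_selfadjoint scale b u \<longleftrightarrow>
     Vector_Spaces.linear scale scale u \<and> (\<forall>x y. b (u x) y = - b x (u y))"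

end

theory Submission
  imports Defs "HOL-Library.Set_Algebras"
begin

text \<open>
  It suffices to find two totally isotropic subspaces \<open>L\<close> and \<open>L'\<close> with \<open>V = L + L'\<close> that \<open>u\<close>
  exchanges, \<open>u L \<subseteq> L'\<close> and \<open>u L' \<subseteq> L\<close>: if \<open>\<pi>\<close> is the projection onto \<open>L\<close> along \<open>L'\<close>, then
  \<open>u \<circ> \<pi>\<close> and \<open>u \<circ> (id - \<pi>)\<close> are square-zero, and isotropy makes them skew-selfadjoint
  (\<open>square_zero_summands\<close>). In block form, such an \<open>u\<close> has zero diagonal blocks, and the two
  summands are its off-diagonal blocks.

  The pair \<open>(L, L')\<close> is built by splitting \<open>V\<close> orthogonally, by induction on the dimension
  (\<open>polarization_exists\<close>). The tool is \<open>w = u\<^sup>2\<close>, which is selfadjoint. Hence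
  \<open>b (f(w) x) (g(w) x) = 0\<close> for all polynomials \<open>f\<close>, \<open>g\<close>: every cyclic space \<open>F[w] x\<close> is isotropic,
  so is \<open>u F[w] x\<close>, and \<open>u\<close> exchanges the two. If their sum is nondegenerate, it is an orthogonal
  summand of the required kind and the induction goes on with its orthogonal complement.

  To find such an \<open>x\<close>, note that the Fitting decomposition of any \<open>f(w)\<close> is orthogonal, so one may
  assume that each \<open>f(w)\<close> is injective or nilpotent. Let \<open>p\<close> be a nonzero polynomial of least degree
  with \<open>p(w)\<close> nilpotent, say of index \<open>e + 1\<close>. The form \<open>(x, y) \<mapsto> b x (u p(w)\<^sup>e y)\<close> is
  symmetric, so if it is not zero then, the characteristic not being 2, it does not vanish on some
  \<open>(x, x)\<close>, and this \<open>x\<close> works (\<open>polarized_summand_cyclic\<close>). The form is zero only if \<open>u\<close> is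
  nilpotent of odd index \<open>2 e + 1\<close>. Then one cyclic space is not enough: Jordan blocks
  of odd size occur in pairs, and a pair is caught by two vectors \<open>x\<close>, \<open>y\<close> with
  \<open>b (u\<^sup>2\<^sup>e x) y \<noteq> 0\<close> and \<open>b (u\<^sup>j x) y = 0\<close> for odd \<open>j\<close>, by \<open>L = F[w] x + u F[w] y\<close> and
  \<open>L' = u F[w] x + F[w] y\<close> (\<open>polarized_summand_bicyclic\<close>).
\<close>

section \<open>Linear endomorphisms and their polynomials\<close>

locale fin_dim_space = finite_dimensional_vector_space scale Basis
  for scale :: "'a::field \<Rightarrow> 'b::ab_group_add \<Rightarrow> 'b" and Basis :: "'b set"
begin

abbreviation endo :: "('b \<Rightarrow> 'b) \<Rightarrow> bool" where
  "endo g \<equiv> Vector_Spaces.linear scale scale g"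

lemma endo_iff:
  "endo g \<longleftrightarrow> (\<forall>x y. g (x + y) = g x + g y) \<and> (\<forall>c x. g (scale c x) = scale c (g x))"
  using vector_space_axioms by (auto simp: Vector_Spaces.linear_iff)

lemma endo_add: "endo g \<Longrightarrow> g (x + y) = g x + g y"
  and endo_scale: "endo g \<Longrightarrow> g (scale c x) = scale c (g x)"
  by (auto simp: endo_iff)

lemma endo_0: "endo g \<Longrightarrow> g 0 = 0"
  using endo_scale[of g 0 0] by simp

lemma endo_diff: "endo g \<Longrightarrow> g (x - y) = g x - g y"
  using endo_add[of g "x - y" y] by (simp add: algebra_simps)

lemma endo_funpow: "endo g \<Longrightarrow> endo (g ^^ n)"
  by (induction n) (auto simp: endo_iff)

lemma subspace_endo_image: "endo g \<Longrightarrow> subspace S \<Longrightarrow> subspace (g ` S)"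
  unfolding subspace_def
  by (auto simp: image_iff) (metis endo_0, metis endo_add, metis endo_scale)

lemma funpow_closed: "g ` S \<subseteq> S \<Longrightarrow> x \<in> S \<Longrightarrow> (g ^^ n) x \<in> S"
  by (induction n) auto

definition poly_map :: "('b \<Rightarrow> 'b) \<Rightarrow> 'a poly \<Rightarrow> 'b \<Rightarrow> 'b" where
  "poly_map g f v = fold_coeffs (\<lambda>a z. scale a v + g z) f 0"

lemma poly_map_0 [simp]: "poly_map g 0 v = 0"
  by (simp add: poly_map_def)

lemma poly_map_pCons: "endo g \<Longrightarrow> poly_map g (pCons a f) v = scale a v + g (poly_map g f v)"
  by (cases "a = 0 \<and> f = 0") (auto simp: poly_map_def endo_0)

lemma endo_poly_map: "endo g \<Longrightarrow> endo (poly_map g f)"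
  by (induction f)
    (auto simp: endo_iff poly_map_pCons scale_right_distrib algebra_simps)

lemma poly_map_add: "endo g \<Longrightarrow> poly_map g (f + h) v = poly_map g f v + poly_map g h v"
  by (induction f h rule: poly_induct2)
    (auto simp: poly_map_pCons endo_add scale_left_distrib algebra_simps)

lemma poly_map_smult: "endo g \<Longrightarrow> poly_map g (smult c f) v = scale c (poly_map g f v)"
  by (induction f) (auto simp: poly_map_pCons endo_scale scale_right_distrib)

lemma poly_map_mult: "endo g \<Longrightarrow> poly_map g (f * h) v = poly_map g f (poly_map g h v)"
  by (induction f) (auto simp: poly_map_pCons poly_map_add poly_map_smult)

lemma poly_map_diff: "endo g \<Longrightarrow> poly_map g (f - h) v = poly_map g f v - poly_map g h v"
  using poly_map_add[of g "f - h" h v] by simp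

lemma poly_map_1 [simp]: "endo g \<Longrightarrow> poly_map g 1 v = v"
  using poly_map_pCons[of g 1 0 v] by (simp add: endo_0 one_pCons)

lemma poly_map_const: "endo g \<Longrightarrow> poly_map g [:c:] v = scale c v"
  by (simp add: poly_map_pCons endo_0)

lemma poly_map_X: "endo g \<Longrightarrow> poly_map g [:0, 1:] v = g v"
  by (simp add: poly_map_pCons endo_0)

lemma poly_map_power: "endo g \<Longrightarrow> poly_map g (f ^ n) v = (poly_map g f ^^ n) v"
  by (induction n) (auto simp: poly_map_mult)

lemma poly_map_closed:
  assumes "endo g" "subspace S" "g ` S \<subseteq> S" "v \<in> S"
  shows "poly_map g f v \<in> S"
  using assms
  by (induction f) (auto simp: poly_map_pCons subspace_0 intro!: subspace_add subspace_scale)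

definition cyclic :: "('b \<Rightarrow> 'b) \<Rightarrow> 'b \<Rightarrow> 'b set" where
  "cyclic g x = range (\<lambda>f. poly_map g f x)"

lemma subspace_cyclic: "endo g \<Longrightarrow> subspace (cyclic g x)"
  unfolding subspace_def cyclic_def
  by (auto simp: image_iff)
    (metis poly_map_0, metis poly_map_add, metis poly_map_smult)

lemma cyclic_self: "endo g \<Longrightarrow> x \<in> cyclic g x"
  unfolding cyclic_def by (rule image_eqI[of _ _ 1]) auto

lemma cyclic_poly_map: "endo g \<Longrightarrow> z \<in> cyclic g x \<Longrightarrow> poly_map g f z \<in> cyclic g x"
  unfolding cyclic_def by (auto simp flip: poly_map_mult)

lemma cyclic_closed: "endo g \<Longrightarrow> z \<in> cyclic g x \<Longrightarrow> g z \<in> cyclic g x"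
  using cyclic_poly_map[of g z x "[:0, 1:]"] by (simp add: poly_map_X)

lemma cyclic_subset:
  "endo g \<Longrightarrow> subspace S \<Longrightarrow> g ` S \<subseteq> S \<Longrightarrow> x \<in> S \<Longrightarrow> cyclic g x \<subseteq> S"
  unfolding cyclic_def using poly_map_closed by blast

lemma cyclic_cases:
  assumes "endo g" "z \<in> cyclic g x"
  obtains c z' where "z' \<in> cyclic g x" "z = scale c x + g z'"
proof -
  obtain f where z: "z = poly_map g f x"
    using assms(2) by (auto simp: cyclic_def)
  obtain c f' where "f = pCons c f'"
    by (cases f)
  with z assms(1) have "z = scale c x + g (poly_map g f' x)"
    by (simp add: poly_map_pCons)
  then show thesis
    using that by (auto simp: cyclic_def)
qed

text \<open>The images of the powers decrease, so one of least dimension is mapped onto itself.\<close>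

lemma stable_image_exists:
  assumes "endo g" "subspace S" "g ` S \<subseteq> S"
  obtains n where "(g ^^ Suc n) ` S = (g ^^ n) ` S"
proof -
  obtain n where n: "\<And>m. dim ((g ^^ n) ` S) \<le> dim ((g ^^ m) ` S)"
    using ex_has_least_nat[of "\<lambda>_. True" 0 "\<lambda>n. dim ((g ^^ n) ` S)"] by auto
  have "(g ^^ Suc n) ` S \<subseteq> (g ^^ n) ` S"
    using assms(3) by (auto simp: funpow_Suc_right simp del: funpow.simps)
  then have "(g ^^ Suc n) ` S = (g ^^ n) ` S"
    by (intro subspace_dim_equal n subspace_endo_image endo_funpow assms)
  then show thesis by (rule that)
qed

lemma injective_endo_surj:
  assumes g: "endo g" "subspace S" "g ` S \<subseteq> S"
    and inj: "\<And>x. x \<in> S \<Longrightarrow> g x = 0 \<Longrightarrow> x = 0" and x: "x \<in> S"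
  obtains y where "y \<in> S" "g y = x"
proof -
  obtain n where n: "(g ^^ Suc n) ` S = (g ^^ n) ` S"
    using stable_image_exists[OF g] .
  have injn: "z \<in> S \<Longrightarrow> (g ^^ m) z = 0 \<Longrightarrow> z = 0" for m z
    by (induction m) (auto intro: inj funpow_closed[OF g(3)])
  obtain y where y: "y \<in> S" "(g ^^ n) x = (g ^^ Suc n) y"
    using n x by blast
  have "(g ^^ n) (x - g y) = 0"
    using y(2) g(1) by (simp add: endo_diff endo_funpow funpow_swap1)
  moreover have "x - g y \<in> S"
    using x y(1) g by (auto intro: subspace_diff)
  ultimately have "x = g y"
    using injn by fastforce
  with y(1) show thesis by (auto intro: that)
qed

text \<open>
  On the cyclic space of \<open>x\<close> the images of the powers of \<open>g\<close> stabilise, so \<open>g\<^sup>n x = g\<^sup>n\<^sup>+\<^sup>1 h(g) x\<close>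
  for some \<open>h\<close>; the polynomial \<open>X\<^sup>n (1 - X h)\<close> is not zero because of its coefficient at \<open>X\<^sup>n\<close>.
\<close>

lemma annihilating_poly_exists:
  assumes g: "endo g"
  obtains f where "f \<noteq> 0" "poly_map g f x = 0"
proof -
  have inv: "g ` cyclic g x \<subseteq> cyclic g x"
    using cyclic_closed[OF g] by auto
  obtain n where n: "(g ^^ Suc n) ` cyclic g x = (g ^^ n) ` cyclic g x"
    using stable_image_exists[OF g subspace_cyclic[OF g] inv] .
  then obtain h where h: "(g ^^ n) x = (g ^^ Suc n) (poly_map g h x)"
    using cyclic_self[OF g, of x] by (force simp: cyclic_def)
  define X :: "'a poly" where "X = [:0, 1:]"
  have "poly_map g X = g"
    using g by (simp add: X_def poly_map_X fun_eq_iff)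
  then have X: "poly_map g (X ^ m) v = (g ^^ m) v" for m v
    using g by (simp add: poly_map_power)
  let ?f = "X ^ n * (1 - X * h)"
  have "coeff (1 - X * h) 0 = 1"
    by (simp add: X_def)
  then have "1 - X * h \<noteq> 0"
    by (metis coeff_0 zero_neq_one)
  then have "?f \<noteq> 0"
    by (simp add: X_def)
  moreover have "poly_map g ?f x = 0"
    using g h X[of 1]
    by (simp add: poly_map_mult poly_map_diff X endo_diff endo_funpow funpow_swap1)
  ultimately show thesis by (rule that)
qed

end

section \<open>A skew-selfadjoint endomorphism of an alternating form\<close>

locale skew_endomorphism = fin_dim_space scale Basis
  for scale :: "'f::field \<Rightarrow> 'v::ab_group_add \<Rightarrow> 'v" and Basis :: "'v set" +
  fixes b :: "'v \<Rightarrow> 'v \<Rightarrow> 'f" and u :: "'v \<Rightarrow> 'v"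
  assumes two_neq_0: "(2::'f) \<noteq> 0"
    and bilinear: "bilinear_form scale b"
    and alternating: "alternating_form b"
    and skew: "skew_selfadjoint scale b u"
begin

lemma b_add_right: "b x (y + z) = b x y + b x z"
  and b_scale_right: "b x (scale c y) = c * b x y"
  and b_add_left: "b (x + y) z = b x z + b y z"
  and b_scale_left: "b (scale c x) y = c * b x y"
  using bilinear by (auto simp: bilinear_form_def Vector_Spaces.linear_iff)

lemma b_zero_right [simp]: "b x 0 = 0" and b_zero_left [simp]: "b 0 x = 0"
  using b_scale_right[of x 0 0] b_scale_left[of 0 0 x] by simp_all

lemma b_diff_right: "b x (y - z) = b x y - b x z"
  using b_add_right[of x "y - z" z] by simp

lemma b_diff_left: "b (x - y) z = b x z - b y z"
  using b_add_left[of "x - y" y z] by simp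

lemma b_self [simp]: "b x x = 0"
  using alternating by (simp add: alternating_form_def)

lemma b_antisym: "b x y = - b y x"
proof -
  have "b (x + y) (x + y) = 0" by (rule b_self)
  then show ?thesis
    by (simp add: b_add_left b_add_right eq_neg_iff_add_eq_0 del: b_self) (simp add: add.commute)
qed

lemma b_eq_0_sym: "b x y = 0 \<longleftrightarrow> b y x = 0"
  using b_antisym[of x y] by simp

lemma endo_u: "endo u"
  using skew by (simp add: skew_selfadjoint_def)

lemma b_u: "b (u x) y = - b x (u y)"
  using skew by (simp add: skew_selfadjoint_def)

lemma eq_neg_self_iff: "a = - a \<longleftrightarrow> a = 0" for a :: 'f
proof -
  have "a = - a \<longleftrightarrow> 2 * a = 0"
    by (metis add_eq_0_iff mult_2)
  then show ?thesis using two_neq_0 by simp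
qed

definition w :: "'v \<Rightarrow> 'v" where "w x = u (u x)"

lemma endo_w: "endo w"
  using endo_u by (simp add: w_def endo_iff)

abbreviation act :: "'f poly \<Rightarrow> 'v \<Rightarrow> 'v" where "act \<equiv> poly_map w"

lemmas u_simps = endo_add[OF endo_u] endo_scale[OF endo_u] endo_0[OF endo_u] endo_diff[OF endo_u]
lemmas endo_act = endo_poly_map[OF endo_w]
lemmas act_simps = poly_map_pCons[OF endo_w] poly_map_add[OF endo_w] poly_map_smult[OF endo_w]

lemma u_w: "u (w x) = w (u x)"
  by (simp add: w_def)

lemma u_act: "u (act f x) = act f (u x)"
  by (induction f) (auto simp: act_simps u_simps u_w)

lemma w_act: "w (act f x) = act f (w x)"
  by (simp add: w_def u_act)

lemma b_w: "b (w x) y = b x (w y)"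
  by (simp add: w_def b_u)

lemma b_act: "b (act f x) y = b x (act f y)"
  by (induction f arbitrary: y)
    (auto simp: act_simps b_add_left b_add_right b_scale_left b_scale_right b_w simp flip: w_act)

text \<open>
  As \<open>f(w)\<close> is selfadjoint and \<open>b\<close> is antisymmetric, the value equals its own negative.
\<close>

lemma b_act_self: "b x (act f x) = 0"
  using b_act[of f x x] b_antisym[of x "act f x"] by (simp add: eq_neg_self_iff)

lemma act_X_power: "act ([:0, 1:] ^ n) x = (w ^^ n) x"
proof -
  have "act [:0, 1:] = w"
    using endo_w by (simp add: poly_map_X fun_eq_iff)
  then show ?thesis
    using endo_w by (simp add: poly_map_power)
qed

lemma u_power_even: "(u ^^ (2 * n)) x = (w ^^ n) x"
  by (induction n) (auto simp: w_def)

section \<open>Orthogonality and nondegenerate subspaces\<close>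

definition nondeg :: "'v set \<Rightarrow> bool" where
  "nondeg S \<longleftrightarrow> (\<forall>x\<in>S. (\<forall>y\<in>S. b x y = 0) \<longrightarrow> x = 0)"

definition orthogonal :: "'v set \<Rightarrow> 'v set \<Rightarrow> bool" where
  "orthogonal S T \<longleftrightarrow> (\<forall>x\<in>S. \<forall>y\<in>T. b x y = 0)"

abbreviation isotropic :: "'v set \<Rightarrow> bool" where
  "isotropic S \<equiv> orthogonal S S"

lemma orthogonal_sym: "orthogonal S T \<Longrightarrow> orthogonal T S"
  unfolding orthogonal_def using b_eq_0_sym by blast

lemma isotropic_sum:
  "isotropic S \<Longrightarrow> isotropic T \<Longrightarrow> orthogonal S T \<Longrightarrow> isotropic (S + T)"
  using orthogonal_sym[of S T]
  by (auto simp: orthogonal_def set_plus_def b_add_left b_add_right)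

lemma subspace_plus:
  assumes "subspace S" "subspace T"
  shows "subspace (S + T)"
proof -
  have "S + T = {x + y |x y. x \<in> S \<and> y \<in> T}"
    by (auto simp: set_plus_def)
  then show ?thesis
    using assms by (simp add: subspace_sums)
qed

lemma subset_sum_left: "subspace T \<Longrightarrow> S \<subseteq> S + T"
  using subspace_0[of T] by (force simp: set_plus_def)

lemma subset_sum_right: "subspace S \<Longrightarrow> T \<subseteq> S + T"
  using subspace_0[of S] by (force simp: set_plus_def)

lemma nondeg_summand:
  assumes "nondeg W" "W = S + T" "orthogonal S T" "subspace T"
  shows "nondeg S"
  unfolding nondeg_def
proof (intro ballI impI)
  fix x assume x: "x \<in> S" "\<forall>y\<in>S. b x y = 0"
  then have "\<forall>y\<in>W. b x y = 0"
    using assms(2,3) by (auto simp: set_plus_def orthogonal_def b_add_right)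
  moreover have "x \<in> W"
    using x(1) assms(2) subset_sum_left[OF assms(4)] by blast
  ultimately show "x = 0"
    using assms(1) by (auto simp: nondeg_def)
qed

text \<open>
  This says that a subspace of a nondegenerate \<open>W\<close> is its own double orthogonal. In the step, \<open>y1\<close>
  is dual to the new vector \<open>t\<close>; subtracting multiples of \<open>t\<close> from \<open>v\<close>, and of \<open>y1\<close> from the
  vector found for the result, makes the pairing with \<open>t\<close> vanish.
\<close>

lemma separating_vector:
  assumes W: "subspace W" "nondeg W" and "finite T" "T \<subseteq> W" "v \<in> W" "v \<notin> span T"
  shows "\<exists>y\<in>W. (\<forall>t\<in>T. b t y = 0) \<and> b v y \<noteq> 0"
  using assms(3-)
proof (induction T arbitrary: v)
  case empty
  then show ?case using W(2) by (auto simp: nondeg_def)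
next
  case (insert t T)
  show ?case
  proof (cases "t \<in> span T")
    case True
    then have "v \<notin> span T"
      using insert.prems(3) span_redundant by blast
    then obtain y where y: "y \<in> W" "\<forall>s\<in>T. b s y = 0" "b v y \<noteq> 0"
      using insert by blast
    have "subspace {s. b s y = 0}"
      by (auto simp: subspace_def b_add_left b_scale_left)
    then have "span T \<subseteq> {s. b s y = 0}"
      using y(2) by (intro span_minimal) auto
    then show ?thesis using y True by auto
  next
    case False
    then obtain y0 where y0: "y0 \<in> W" "\<forall>s\<in>T. b s y0 = 0" "b t y0 \<noteq> 0"
      using insert by blast
    define y1 where "y1 = scale (inverse (b t y0)) y0"
    have y1: "y1 \<in> W" "\<forall>s\<in>T. b s y1 = 0" "b t y1 = 1"
      using y0 W(1) by (auto simp: y1_def b_scale_right subspace_scale)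
    define v' where "v' = v - scale (b v y1) t"
    have "v' \<in> W"
      using insert.prems W(1) by (auto simp: v'_def intro!: subspace_diff subspace_scale)
    moreover have "v' \<notin> span T"
      using insert.prems(3) by (auto simp: v'_def span_insert)
    ultimately obtain y2 where y2: "y2 \<in> W" "\<forall>s\<in>T. b s y2 = 0" "b v' y2 \<noteq> 0"
      using insert by blast
    let ?y = "y2 - scale (b t y2) y1"
    have "?y \<in> W"
      using y1 y2 W(1) by (auto intro!: subspace_diff subspace_scale)
    moreover have "\<forall>s\<in>insert t T. b s ?y = 0"
      using y1 y2 by (auto simp: b_diff_right b_scale_right)
    moreover have "b v ?y = b v' y2"
      by (simp add: v'_def b_diff_right b_scale_right b_diff_left b_scale_left)
    ultimately show ?thesis using y2(3) by auto
  qed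
qed

lemma separating_vector_subspace:
  assumes "subspace W" "nondeg W" "subspace S" "S \<subseteq> W" "v \<in> W" "v \<notin> S"
  obtains y where "y \<in> W" "\<forall>s\<in>S. b s y = 0" "b v y \<noteq> 0"
proof -
  obtain T where T: "T \<subseteq> S" "independent T" "S \<subseteq> span T"
    using basis_exists[of S] by metis
  have "span T = S"
    using T assms(3) by (simp add: span_subspace)
  then obtain y where y: "y \<in> W" "\<forall>t\<in>T. b t y = 0" "b v y \<noteq> 0"
    using separating_vector[OF assms(1,2) finiteI_independent[OF T(2)], of v] T(1) assms(4-6) by auto
  have "subspace {s. b s y = 0}"
    by (auto simp: subspace_def b_add_left b_scale_left)
  then have "span T \<subseteq> {s. b s y = 0}"
    using y(2) by (intro span_minimal) auto
  then show thesis
    using y \<open>span T = S\<close> by (intro that) auto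
qed

definition perp :: "'v set \<Rightarrow> 'v set" where
  "perp C = {v. \<forall>z\<in>C. b z v = 0}"

lemma subspace_perp: "subspace (perp C)"
  by (auto simp: subspace_def perp_def b_add_right b_scale_right)

text \<open>
  Separating each element of a basis of \<open>C\<close> from the others gives a dual basis up to scalars, hence
  the orthogonal projection onto \<open>C\<close>.
\<close>

lemma nondeg_complement:
  assumes C: "subspace C" "nondeg C"
  shows "UNIV = C + perp C"
proof -
  obtain T where T: "T \<subseteq> C" "independent T" "C \<subseteq> span T"
    using basis_exists[of C] by metis
  have fin: "finite T"
    using T(2) by (rule finiteI_independent)
  have "\<exists>y\<in>C. (\<forall>s\<in>T - {t}. b s y = 0) \<and> b t y \<noteq> 0" if "t \<in> T" for t
    using that T fin by (intro separating_vector C) (auto simp: dependent_def)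
  then obtain d where d: "\<And>t. t \<in> T \<Longrightarrow> d t \<in> C"
    "\<And>t s. t \<in> T \<Longrightarrow> s \<in> T \<Longrightarrow> s \<noteq> t \<Longrightarrow> b s (d t) = 0" "\<And>t. t \<in> T \<Longrightarrow> b t (d t) \<noteq> 0"
    by (metis insert_Diff insert_iff)
  have b_sum: "b s (sum h A) = (\<Sum>t\<in>A. b s (h t))" for s h and A :: "'v set"
    by (induction A rule: infinite_finite_induct) (auto simp: b_add_right)
  have "v \<in> C + perp C" for v
  proof -
    define c where "c = (\<Sum>t\<in>T. scale (b t v / b t (d t)) (d t))"
    have c: "c \<in> C"
      unfolding c_def by (intro subspace_sum subspace_scale C d)
    have "b s (v - c) = 0" if s: "s \<in> T" for s
    proof -
      have "b s c = (\<Sum>t\<in>T. if t = s then b s v else 0)"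
        unfolding c_def b_sum using d s by (intro sum.cong) (auto simp: b_scale_right)
      then show ?thesis
        using s fin by (simp add: b_diff_right)
    qed
    moreover have "subspace {s. b s (v - c) = 0}"
      by (auto simp: subspace_def b_add_left b_scale_left)
    ultimately have "span T \<subseteq> {s. b s (v - c) = 0}"
      by (intro span_minimal) auto
    then have "v - c \<in> perp C"
      using T(3) by (auto simp: perp_def)
    then show ?thesis
      using set_plus_intro[OF c, of "v - c" "perp C"] by simp
  qed
  then show ?thesis by blast
qed

section \<open>Exchanged polarizations\<close>

text \<open>
  For a nondegenerate \<open>W\<close> the sum is automatically direct, so that \<open>L\<close> and \<open>L'\<close> are complementary
  Lagrangian subspaces of \<open>W\<close>.
\<close>

definition polarized :: "'v set \<Rightarrow> 'v set \<Rightarrow> 'v set \<Rightarrow> bool" where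
  "polarized W L L' \<longleftrightarrow> subspace L \<and> subspace L' \<and> W = L + L' \<and>
     isotropic L \<and> isotropic L' \<and> u ` L \<subseteq> L' \<and> u ` L' \<subseteq> L"

lemma polarized_subspace: "polarized W L L' \<Longrightarrow> subspace W"
  by (simp add: polarized_def subspace_plus)

lemma polarized_closed: "polarized W L L' \<Longrightarrow> u ` W \<subseteq> W"
  unfolding polarized_def
  by (auto simp: set_plus_def u_simps) (metis add.commute image_subset_iff)

lemma u_plus_closed: "u ` S \<subseteq> S' \<Longrightarrow> u ` T \<subseteq> T' \<Longrightarrow> u ` (S + T) \<subseteq> S' + T'"
  by (auto simp: set_plus_def u_simps) blast

lemma orthogonal_mono: "orthogonal S T \<Longrightarrow> S' \<subseteq> S \<Longrightarrow> T' \<subseteq> T \<Longrightarrow> orthogonal S' T'"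
  by (auto simp: orthogonal_def)

lemma polarized_plus:
  assumes 1: "polarized S L L'" and 2: "polarized T M M'" and orth: "orthogonal S T"
  shows "polarized (S + T) (L + M) (L' + M')"
proof -
  have "L \<subseteq> S" "L' \<subseteq> S" "M \<subseteq> T" "M' \<subseteq> T"
    using 1 2 subset_sum_left subset_sum_right by (auto simp: polarized_def)
  then have "orthogonal L M" "orthogonal L' M'"
    using orth by (auto intro: orthogonal_mono)
  moreover have "S + T = (L + M) + (L' + M')"
    using 1 2 by (simp add: polarized_def ac_simps)
  ultimately show ?thesis
    using 1 2
    by (auto simp: polarized_def u_plus_closed intro!: subspace_plus isotropic_sum)
qed

definition has_polarized_summand :: "'v set \<Rightarrow> bool" where
  "has_polarized_summand W \<longleftrightarrow>
     (\<exists>C L L'. C \<subseteq> W \<and> C \<noteq> {0} \<and> nondeg C \<and> polarized C L L')"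

lemma act_closed: "subspace W \<Longrightarrow> u ` W \<subseteq> W \<Longrightarrow> x \<in> W \<Longrightarrow> act f x \<in> W"
  by (rule poly_map_closed[OF endo_w]) (auto simp: w_def)

lemma isotropic_cyclic: "isotropic (cyclic w x)"
proof -
  have "b (act f x) (act g x) = b x (act (f * g) x)" for f g
    by (simp add: b_act poly_map_mult[OF endo_w])
  then show ?thesis
    by (auto simp: orthogonal_def cyclic_def b_act_self)
qed

lemma isotropic_u_cyclic: "isotropic (u ` cyclic w x)"
proof -
  have "b (u y) (u z) = 0" if "y \<in> cyclic w x" "z \<in> cyclic w x" for y z
    using isotropic_cyclic[of x] that cyclic_closed[OF endo_w that(2)]
    by (auto simp: orthogonal_def b_u simp flip: w_def)
  then show ?thesis
    by (auto simp: orthogonal_def)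
qed

lemma u_u_cyclic: "u ` u ` cyclic w x \<subseteq> cyclic w x"
  using cyclic_closed[OF endo_w] by (auto simp flip: w_def)

text \<open>
  Let \<open>h = p(w)\<^sup>e\<close>. The vector \<open>x\<close> is chosen with \<open>b x (u h x) \<noteq> 0\<close>. The sum of \<open>A = F[w] x\<close> and
  \<open>u A\<close> is nondegenerate once the radical \<open>R\<close> of the form \<open>(y, z) \<mapsto> b y (u z)\<close> on \<open>A\<close> is zero.
  A nonzero element of \<open>R\<close> could be written \<open>p(w)\<^sup>d s(w) x\<close> with \<open>d \<le> e\<close> and \<open>s\<close> not divisible by \<open>p\<close>.
  Applying \<open>p(w)\<^sup>e\<^sup>-\<^sup>d\<close> would put \<open>r(w) h x\<close> into \<open>R\<close>, where \<open>r\<close> is the remainder of \<open>s\<close> modulo \<open>p\<close>;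
  since \<open>r(w)\<close> is injective, hence bijective on \<open>R\<close>, this gives \<open>h x \<in> R\<close>, against the choice of \<open>x\<close>.
\<close>

lemma polarized_summand_cyclic:
  assumes W: "subspace W" "u ` W \<subseteq> W" "nondeg W"
    and p: "p \<noteq> 0" "\<And>v. v \<in> W \<Longrightarrow> act (p ^ Suc e) v = 0"
    and z: "z \<in> W" "u (act (p ^ e) z) \<noteq> 0"
    and inj: "\<And>r v. r \<noteq> 0 \<Longrightarrow> degree r < degree p \<Longrightarrow> v \<in> W \<Longrightarrow> act r v = 0 \<Longrightarrow> v = 0"
  shows "has_polarized_summand W"
proof -
  have closed: "u v \<in> W" "act f v \<in> W" if "v \<in> W" for v f
    using that W(2) act_closed[OF W(1,2)] by auto
  \<comment> \<open>The form \<open>?q\<close> is symmetric; if it vanished on the diagonal it would vanish by polarization.\<close>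
  have "\<exists>x\<in>W. b x (u (act (p ^ e) x)) \<noteq> 0"
  proof (rule ccontr)
    let ?q = "\<lambda>x y. b x (u (act (p ^ e) y))"
    assume "\<not> ?thesis"
    then have null: "?q x x = 0" if "x \<in> W" for x
      using that by blast
    have "?q x z = 0" if x: "x \<in> W" for x
    proof -
      have "?q (x + z) (x + z) = 0"
        using x z(1) W(1) by (intro null subspace_add)
      then have "?q x z + ?q z x = 0"
        using null[OF x] null[OF z(1)]
        by (simp add: endo_add[OF endo_act] u_simps b_add_left b_add_right add.commute)
      moreover have "?q z x = ?q x z"
        using b_antisym[of z "u (act (p ^ e) x)"] by (simp add: b_u b_act u_act)
      ultimately have "2 * ?q x z = 0"
        by simp
      then show ?thesis
        using two_neq_0 by (metis mult_eq_0_iff)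
    qed
    then have "\<forall>x\<in>W. b (u (act (p ^ e) z)) x = 0"
      using b_eq_0_sym by blast
    then show False
      using W(3) z closed by (auto simp: nondeg_def)
  qed
  then obtain x where x: "x \<in> W" "b x (u (act (p ^ e) x)) \<noteq> 0"
    by blast
  let ?A = "cyclic w x"
  have A: "subspace ?A" "x \<in> ?A" "?A \<subseteq> W"
    using subspace_cyclic[OF endo_w] cyclic_self[OF endo_w] cyclic_subset[OF endo_w W(1) _ x(1)] closed(1)
    by (simp_all add: w_def image_subset_iff)
  define R where "R = {z \<in> ?A. \<forall>y\<in>?A. b z (u y) = 0}"
  have R_sub: "subspace R"
    using A(1) by (auto simp: R_def subspace_def b_add_left b_scale_left)
  have R_act: "act f z \<in> R" if "z \<in> R" for f z
    using that by (auto simp: R_def b_act simp flip: u_act intro!: cyclic_poly_map[OF endo_w])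
  have R_W: "R \<subseteq> W"
    using A(3) by (auto simp: R_def)
  have not_R: "act (p ^ e) x \<notin> R"
    using x(2) A(2) by (auto simp: R_def b_act simp flip: u_act)
  \<comment> \<open>Elements of \<open>R\<close> are divisible by ever higher powers of \<open>p(w)\<close>, and \<open>p(w)\<^sup>e\<^sup>+\<^sup>1 = 0\<close>.\<close>
  have deep: "\<exists>s. v = act (p ^ d) (act s x)" if "v \<in> R" "d \<le> Suc e" for v d
    using that(2)
  proof (induction d)
    case 0
    then show ?case
      using that(1) endo_w by (auto simp: R_def cyclic_def)
  next
    case (Suc d)
    then obtain s where s: "v = act (p ^ d) (act s x)"
      by auto
    define q r where "q = s div p" and "r = s mod p"
    have sqr: "s = q * p + r"
      by (simp add: q_def r_def)
    have "r = 0"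
    proof (rule ccontr)
      assume r: "r \<noteq> 0"
      then have deg: "degree r < degree p"
        using degree_mod_less[OF p(1), of s] by (simp add: r_def)
      have "act (p ^ (e - d)) v = act (p ^ e) (act s x)"
        using Suc.prems by (simp add: s flip: poly_map_mult[OF endo_w] power_add mult.assoc)
      also have "\<dots> = act q (act (p ^ Suc e) x) + act r (act (p ^ e) x)"
        by (simp add: sqr algebra_simps flip: poly_map_mult[OF endo_w] poly_map_add[OF endo_w])
      also have "\<dots> = act r (act (p ^ e) x)"
        using p(2)[OF x(1)] endo_0[OF endo_act] by simp
      finally have "act r (act (p ^ e) x) \<in> R"
        using R_act[OF that(1), of "p ^ (e - d)"] by simp
      then obtain y where y: "y \<in> R" "act r y = act r (act (p ^ e) x)"
        using injective_endo_surj[OF endo_act[of r] R_sub, of "act r (act (p ^ e) x)"]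
          R_act inj[OF r deg] R_W by blast
      have "act r (y - act (p ^ e) x) = 0"
        using y(2) by (simp add: endo_diff[OF endo_act])
      moreover have "y - act (p ^ e) x \<in> W"
        using y(1) R_W closed(2)[OF x(1)] by (auto intro: subspace_diff[OF W(1)])
      ultimately have "y = act (p ^ e) x"
        using inj[OF r deg] by fastforce
      with y(1) not_R show False by simp
    qed
    then have "v = act (p ^ Suc d) (act q x)"
      by (simp add: s sqr algebra_simps flip: poly_map_mult[OF endo_w])
    then show ?case by blast
  qed
  have R_0: "v = 0" if v: "v \<in> R" for v
  proof -
    obtain s where "v = act (p ^ Suc e) (act s x)"
      using deep[OF v order_refl] by blast
    then show ?thesis
      using p(2) closed(2)[OF x(1)] by simp
  qed
  let ?C = "?A + u ` ?A"
  have uA: "subspace (u ` ?A)"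
    using A(1) by (rule subspace_endo_image[OF endo_u])
  have A_C: "?A \<subseteq> ?C" and uA_C: "u ` ?A \<subseteq> ?C"
    using subset_sum_left[OF uA] subset_sum_right[OF A(1)] by auto
  have "polarized ?C ?A (u ` ?A)"
    using A(1) uA isotropic_cyclic isotropic_u_cyclic u_u_cyclic by (auto simp: polarized_def)
  moreover have "?C \<subseteq> W"
    using A(3) closed(1) W(1) by (auto simp: set_plus_def intro!: subspace_add)
  moreover have "x \<noteq> 0"
    using x(2) by auto
  then have "?C \<noteq> {0}"
    using A(2) A_C by blast
  moreover have "nondeg ?C"
    unfolding nondeg_def
  proof (intro ballI impI)
    fix v assume "v \<in> ?C" and v: "\<forall>y\<in>?C. b v y = 0"
    then obtain y z where yz: "y \<in> ?A" "z \<in> ?A" "v = y + u z"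
      by (auto simp: set_plus_def)
    have "b y (u a) = 0" "b z (u a) = 0" if a: "a \<in> ?A" for a
    proof -
      have "b (u z) (u a) = 0" "b y a = 0"
        using isotropic_cyclic isotropic_u_cyclic yz a by (auto simp: orthogonal_def)
      moreover have "b v (u a) = 0" "b v a = 0"
        using v a A_C uA_C by auto
      ultimately show "b y (u a) = 0" "b z (u a) = 0"
        by (simp_all add: yz(3) b_add_left) (simp add: b_u)
    qed
    then have "y \<in> R" "z \<in> R"
      using yz by (auto simp: R_def)
    then show "v = 0"
      using R_0[of y] R_0[of z] yz(3) by (simp add: u_simps)
  qed
  ultimately show ?thesis
    unfolding has_polarized_summand_def by blast
qed

text \<open>
  This is where the parity enters: \<open>u\<^sup>2\<^sup>e x\<close> is an even power of \<open>u\<close> applied to \<open>x\<close>, and it is not a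
  combination of odd ones. If it were \<open>u\<^sup>2\<^sup>d\<^sup>+\<^sup>1 z\<close> with \<open>z = c x + w z'\<close> and \<open>d < e\<close>, then applying
  \<open>u\<^sup>2\<^sup>e\<^sup>-\<^sup>2\<^sup>d\<^sup>-\<^sup>1\<close> would give \<open>0 = c u\<^sup>2\<^sup>e x\<close>, so \<open>c = 0\<close> and the exponent can be raised by 2.
\<close>

lemma nilpotent_socle_notin:
  assumes nil: "\<And>v. v \<in> cyclic w x \<Longrightarrow> u ((w ^^ e) v) = 0" and x: "(w ^^ e) x \<noteq> 0"
  shows "(w ^^ e) x \<notin> u ` cyclic w x"
proof
  note wn = endo_funpow[OF endo_w]
  assume "(w ^^ e) x \<in> u ` cyclic w x"
  then have 0: "\<exists>z\<in>cyclic w x. (w ^^ e) x = u ((w ^^ 0) z)"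
    by auto
  have "\<exists>z\<in>cyclic w x. (w ^^ e) x = u ((w ^^ d) z)" if "d \<le> e" for d
    using that
  proof (induction d)
    case (Suc d)
    then obtain z where z: "z \<in> cyclic w x" "(w ^^ e) x = u ((w ^^ d) z)"
      by auto
    obtain c z' where z': "z' \<in> cyclic w x" "z = scale c x + w z'"
      using cyclic_cases[OF endo_w z(1)] .
    have u_wn: "u ((w ^^ n) v) = (w ^^ n) (u v)" for n v
      by (induction n) (auto simp: u_w)
    have wadd: "(w ^^ m) ((w ^^ n) v) = (w ^^ (m + n)) v" for m n v
      by (simp add: funpow_add)
    have "u ((w ^^ (e - Suc d)) ((w ^^ e) x)) = u ((w ^^ (e - Suc d)) (u ((w ^^ d) z)))"
      using z(2) by simp
    also have "\<dots> = (w ^^ (e - Suc d)) (w ((w ^^ d) z))"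
      by (simp add: u_wn w_def)
    also have "\<dots> = (w ^^ e) z"
      using Suc.prems wadd[of "e - Suc d" "Suc d" z] by simp
    also have "\<dots> = scale c ((w ^^ e) x) + w ((w ^^ e) z')"
      by (simp add: z'(2) endo_add[OF wn] endo_scale[OF wn] funpow_swap1)
    also have "w ((w ^^ e) z') = 0"
      using nil[OF z'(1)] by (simp add: w_def u_simps)
    also have "u ((w ^^ (e - Suc d)) ((w ^^ e) x)) = 0"
      using nil[OF cyclic_self[OF endo_w]] endo_0[OF wn] by (simp add: u_wn wadd) (simp add: funpow_add)
    finally have "c = 0"
      using x by simp
    then show ?case
      using z z' by (auto simp: funpow_swap1)
  qed (use 0 in blast)
  then obtain z where "z \<in> cyclic w x" "(w ^^ e) x = u ((w ^^ e) z)"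
    by blast
  then show False
    using nil x by simp
qed

text \<open>
  The vector \<open>y\<close> separates \<open>u\<^sup>2\<^sup>e x\<close> from \<open>u F[w] x\<close>; its orthogonality to the latter makes \<open>L\<close> and \<open>L'\<close>
  isotropic. Their sum \<open>C\<close> is nondegenerate: let \<open>v\<close> be in its radical and \<open>v = u\<^sup>d c\<close>, where
  \<open>c = \<alpha> x + \<beta> y + u c'\<close>. Then \<open>u\<^sup>2\<^sup>e\<^sup>-\<^sup>d v = \<alpha> u\<^sup>2\<^sup>e x + \<beta> u\<^sup>2\<^sup>e y\<close> is again orthogonal to \<open>C\<close>, and pairing
  it with \<open>x\<close> and \<open>y\<close> gives \<open>\<alpha> = \<beta> = 0\<close>. So \<open>v\<close> lies in the image of
  every power of \<open>u\<close>, hence is zero as \<open>u\<^sup>2\<^sup>e\<^sup>+\<^sup>1 = 0\<close>.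
\<close>

lemma polarized_summand_bicyclic:
  assumes W: "subspace W" "u ` W \<subseteq> W" "nondeg W"
    and nil: "\<And>v. v \<in> W \<Longrightarrow> u ((w ^^ e) v) = 0"
    and x: "x \<in> W" "(w ^^ e) x \<noteq> 0"
  shows "has_polarized_summand W"
proof -
  have closed: "u v \<in> W" "w v \<in> W" if "v \<in> W" for v
    using that W(2) by (auto simp: w_def)
  have cyc_W: "cyclic w v \<subseteq> W" if "v \<in> W" for v
    using that closed by (intro cyclic_subset[OF endo_w W(1)]) auto
  let ?A = "cyclic w x"
  have A: "subspace ?A" "x \<in> ?A" "?A \<subseteq> W"
    using subspace_cyclic[OF endo_w] cyclic_self[OF endo_w] cyc_W[OF x(1)] by auto
  obtain y where y: "y \<in> W" "\<forall>s\<in>u ` ?A. b s y = 0" "b ((w ^^ e) x) y \<noteq> 0"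
  proof (rule separating_vector_subspace[OF W(1,3)])
    show "subspace (u ` ?A)"
      using A(1) by (rule subspace_endo_image[OF endo_u])
    show "u ` ?A \<subseteq> W"
      using A(3) closed by auto
    show "(w ^^ e) x \<in> W"
      using x(1) closed by (intro funpow_closed) auto
    show "(w ^^ e) x \<notin> u ` ?A"
      using nil A(3) x(2) by (intro nilpotent_socle_notin) auto
  qed
  let ?B = "cyclic w y"
  have B: "subspace ?B" "y \<in> ?B" "?B \<subseteq> W"
    using subspace_cyclic[OF endo_w] cyclic_self[OF endo_w] cyc_W[OF y(1)] by auto
  have uA: "subspace (u ` ?A)" and uB: "subspace (u ` ?B)"
    using A(1) B(1) by (auto intro: subspace_endo_image[OF endo_u])
  have uAB: "b (u a) c = 0" if a: "a \<in> ?A" and c: "c \<in> ?B" for a c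
  proof -
    obtain f where "c = act f y"
      using c by (auto simp: cyclic_def)
    then have "b (u a) c = b (u (act f a)) y"
      by (simp add: u_act b_act)
    then show ?thesis
      using y(2) cyclic_poly_map[OF endo_w a] by simp
  qed
  let ?L = "?A + u ` ?B" and ?L' = "u ` ?A + ?B"
  let ?C = "?L + ?L'"
  have "orthogonal ?A (u ` ?B)" "orthogonal (u ` ?A) ?B"
    using uAB b_u by (auto simp: orthogonal_def)
  moreover have "u ` ?L \<subseteq> ?L'" "u ` ?L' \<subseteq> ?L"
    using u_u_cyclic u_plus_closed by (auto intro!: u_plus_closed)
  ultimately have pol: "polarized ?C ?L ?L'"
    unfolding polarized_def
    by (intro conjI isotropic_sum subspace_plus A B uA uB isotropic_cyclic isotropic_u_cyclic refl)
  note C = polarized_subspace[OF pol]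
  have L: "subspace ?L" "subspace ?L'"
    using pol by (auto simp: polarized_def)
  have sub: "?A \<subseteq> ?C" "u ` ?A \<subseteq> ?C" "?B \<subseteq> ?C" "u ` ?B \<subseteq> ?C"
    using subset_sum_left[OF L(2), of ?L] subset_sum_right[OF L(1), of ?L']
      subset_sum_left[OF uB, of ?A] subset_sum_right[OF A(1), of "u ` ?B"]
      subset_sum_left[OF B(1), of "u ` ?A"] subset_sum_right[OF uA, of ?B] by blast+
  have "?C \<subseteq> W"
    using A(3) B(3) closed W(1) by (auto simp: set_plus_def intro!: subspace_add)
  moreover have "x \<noteq> 0"
    using x(2) endo_0[OF endo_funpow[OF endo_w]] by auto
  then have "?C \<noteq> {0}"
    using A(2) sub(1) by blast
  moreover have "nondeg ?C"
    unfolding nondeg_def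
  proof (intro ballI impI)
    fix v assume vC: "v \<in> ?C" and v: "\<forall>z\<in>?C. b v z = 0"
    have head: "\<exists>\<alpha> \<beta> c'. c' \<in> ?C \<and> c = scale \<alpha> x + scale \<beta> y + u c'" if c: "c \<in> ?C" for c
    proof -
      obtain a1 b1 a2 b2 where c: "a1 \<in> ?A" "b1 \<in> ?B" "a2 \<in> ?A" "b2 \<in> ?B"
        "c = (a1 + u b1) + (u a2 + b2)"
        using c by (auto simp: set_plus_def)
      obtain \<alpha> a where a: "a \<in> ?A" "a1 = scale \<alpha> x + w a"
        using cyclic_cases[OF endo_w c(1)] .
      obtain \<beta> d where d: "d \<in> ?B" "b2 = scale \<beta> y + w d"
        using cyclic_cases[OF endo_w c(4)] .
      have "u a + b1 + a2 + u d \<in> ?C"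
        using a d c sub by (intro subspace_add C) auto
      moreover have "c = scale \<alpha> x + scale \<beta> y + u (u a + b1 + a2 + u d)"
        by (simp add: c(5) a(2) d(2) w_def u_simps algebra_simps)
      ultimately show ?thesis by blast
    qed
    have ker: "b z ((w ^^ e) z) = 0" for z
      by (simp add: b_act_self flip: act_X_power)
    have self: "b ((w ^^ e) z) t = b z ((w ^^ e) t)" for z t
      by (simp add: b_act flip: act_X_power)
    have u_pow: "b ((u ^^ n) v) z = 0" if "z \<in> ?C" for n z
    proof -
      have "\<forall>z\<in>?C. b ((u ^^ n) v) z = 0"
      proof (induction n)
        case 0
        then show ?case using v by simp
      next
        case (Suc n)
        then show ?case
          using polarized_closed[OF pol] by (auto simp: b_u)
      qed
      then show ?thesis using that by blast
    qed
    have "v \<in> (u ^^ d) ` ?C" if "d \<le> Suc (2 * e)" for d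
      using that
    proof (induction d)
      case 0
      then show ?case using vC by simp
    next
      case (Suc d)
      then obtain c where c: "c \<in> ?C" "v = (u ^^ d) c"
        by auto
      obtain \<alpha> \<beta> c' where c': "c' \<in> ?C" "c = scale \<alpha> x + scale \<beta> y + u c'"
        using head[OF c(1)] by blast
      note wn = endo_funpow[OF endo_w, of e]
      have "(u ^^ (2 * e - d)) v = (u ^^ (2 * e - d + d)) c"
        by (simp add: c(2) funpow_add)
      also have "\<dots> = (w ^^ e) c"
        using Suc.prems by (simp add: u_power_even)
      also have "\<dots> = scale \<alpha> ((w ^^ e) x) + scale \<beta> ((w ^^ e) y) + (w ^^ e) (u c')"
        by (simp add: c'(2) endo_add[OF wn] endo_scale[OF wn])
      also have "(w ^^ e) (u c') = u ((w ^^ e) c')"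
        by (simp add: u_act flip: act_X_power)
      also have "\<dots> = 0"
        using c'(1) \<open>?C \<subseteq> W\<close> nil by blast
      finally have uv: "(u ^^ (2 * e - d)) v = scale \<alpha> ((w ^^ e) x) + scale \<beta> ((w ^^ e) y)"
        by simp
      have "y \<in> ?C" "x \<in> ?C"
        using A(2) B(2) sub by auto
      then have "\<alpha> * b ((w ^^ e) x) y + \<beta> * b ((w ^^ e) y) y = 0"
        "\<alpha> * b ((w ^^ e) x) x + \<beta> * b ((w ^^ e) y) x = 0"
        using u_pow[of _ "2 * e - d"] unfolding uv by (simp_all add: b_add_left b_scale_left)
      moreover have "b ((w ^^ e) y) x \<noteq> 0"
        using y(3) self[of y x] b_eq_0_sym by simp
      ultimately have "\<alpha> = 0" "\<beta> = 0"
        using y(3) by (simp_all add: self ker)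
      then show ?case
        using c c' by (auto simp: funpow_swap1)
    qed
    then obtain c where c: "c \<in> ?C" "v = (u ^^ Suc (2 * e)) c"
      by blast
    then show "v = 0"
      using nil \<open>?C \<subseteq> W\<close> by (auto simp: u_power_even)
  qed
  ultimately show ?thesis
    using pol unfolding has_polarized_summand_def by blast
qed


text \<open>
  Since \<open>f(w)\<^sup>n\<close> is selfadjoint, its kernel and its image are orthogonal to each other, so that this
  is an orthogonal decomposition. As \<open>n \<noteq> 0\<close>, the kernel contains that of \<open>f(w)\<close>.
\<close>

lemma fitting_decomposition:
  assumes W: "subspace W" "u ` W \<subseteq> W"
  obtains n where "n \<noteq> 0" "W = {v \<in> W. act (f ^ n) v = 0} + act (f ^ n) ` W"
proof -
  have "act f ` W \<subseteq> W"
    using act_closed[OF W] by auto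
  then obtain m where m: "(act f ^^ Suc m) ` W = (act f ^^ m) ` W"
    using stable_image_exists[OF endo_act W(1)] by blast
  define n where "n = Suc m"
  have "(act f ^^ Suc n) ` W = act f ` (act f ^^ Suc m) ` W"
    by (simp add: n_def image_comp)
  also have "\<dots> = (act f ^^ n) ` W"
    unfolding m by (simp add: n_def image_comp)
  finally have n: "(act f ^^ Suc n) ` W = (act f ^^ n) ` W" .
  define h where "h = act (f ^ n)"
  have h: "h = act f ^^ n"
    by (simp add: h_def poly_map_power[OF endo_w] fun_eq_iff)
  have "(act f ^^ (m + n)) ` W = (act f ^^ n) ` W" for m
  proof (induction m)
    case (Suc m)
    have "(act f ^^ (Suc m + n)) ` W = act f ` (act f ^^ (m + n)) ` W"
      by (simp add: image_comp)
    also have "\<dots> = (act f ^^ Suc n) ` W"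
      by (simp add: Suc image_comp)
    finally show ?case using n by simp
  qed simp
  from this[of n] have h2: "h ` h ` W = h ` W"
    by (simp add: h image_comp flip: funpow_add)
  have "v \<in> {v \<in> W. h v = 0} + h ` W" if v: "v \<in> W" for v
  proof -
    obtain y where y: "y \<in> W" "h v = h (h y)"
      using h2 v by blast
    have "h (v - h y) = 0" "v - h y \<in> W"
      using y v act_closed[OF W] subspace_diff[OF W(1)] endo_diff[OF endo_act] by (simp_all add: h_def)
    then have "(v - h y) + h y \<in> {v \<in> W. h v = 0} + h ` W"
      using y(1) by (intro set_plus_intro) auto
    then show ?thesis by simp
  qed
  moreover have "{v \<in> W. h v = 0} + h ` W \<subseteq> W"
    using act_closed[OF W] by (auto simp: set_plus_def h_def intro!: subspace_add[OF W(1)])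
  ultimately have "W = {v \<in> W. h v = 0} + h ` W"
    by blast
  then show thesis
    using that[of n] by (simp add: h_def n_def)
qed

text \<open>
  If \<open>u\<close> is injective, then \<open>p\<close> is taken of least degree with \<open>p(w)\<close> not injective. Otherwise \<open>u\<close> is
  nilpotent: for even index, \<open>p = X\<close> does, and for odd index the summand has two generators.
\<close>

lemma polarized_summand_exists:
  assumes W: "subspace W" "u ` W \<subseteq> W" "nondeg W" "W \<noteq> {0}"
    and dichotomy: "\<And>f. (\<forall>v\<in>W. act f v = 0 \<longrightarrow> v = 0) \<or> (\<exists>n. \<forall>v\<in>W. act (f ^ n) v = 0)"
  shows "has_polarized_summand W"
proof -
  obtain x0 where x0: "x0 \<in> W" "x0 \<noteq> 0"
    using W(1,4) subspace_0 by blast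
  show ?thesis
  proof (cases "\<forall>v\<in>W. u v = 0 \<longrightarrow> v = 0")
    case True
    let ?P = "\<lambda>f. f \<noteq> 0 \<and> \<not> (\<forall>v\<in>W. act f v = 0 \<longrightarrow> v = 0)"
    have "\<exists>f. ?P f"
      using annihilating_poly_exists[OF endo_w, of x0] x0 by metis
    then obtain p where p: "?P p" "\<And>r. ?P r \<Longrightarrow> degree p \<le> degree r"
      using exists_least_iff[of "\<lambda>n. \<exists>f. ?P f \<and> degree f = n"]
      by (metis (no_types, lifting) linorder_not_less)
    obtain n where n: "\<forall>v\<in>W. act (p ^ n) v = 0" "\<And>m. m < n \<Longrightarrow> \<not> (\<forall>v\<in>W. act (p ^ m) v = 0)"
      using dichotomy[of p] p(1) exists_least_iff[of "\<lambda>n. \<forall>v\<in>W. act (p ^ n) v = 0"] by blast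
    have "n \<noteq> 0"
      using n(1) x0 endo_w by (intro notI) auto
    then obtain e where e: "n = Suc e"
      using not0_implies_Suc by blast
    then obtain z where z: "z \<in> W" "act (p ^ e) z \<noteq> 0"
      using n(2)[of e] by auto
    then have uz: "u (act (p ^ e) z) \<noteq> 0"
      using True act_closed[OF W(1,2)] by blast
    have inj: "v = 0" if "r \<noteq> 0" "degree r < degree p" "v \<in> W" "act r v = 0" for r v
      using p(2)[of r] that by auto
    show ?thesis
    proof (rule polarized_summand_cyclic[OF W(1-3) _ _ z(1) uz inj])
      show "p \<noteq> 0"
        using p(1) by blast
      show "act (p ^ Suc e) v = 0" if "v \<in> W" for v
        using n(1) e that by blast
    qed
  next
    case False
    let ?X = "[:0, 1:] :: 'f poly"
    obtain v where v: "v \<in> W" "v \<noteq> 0" "u v = 0"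
      using False by blast
    then have "act ?X v = 0"
      by (simp add: poly_map_X[OF endo_w] w_def u_simps)
    then have "\<not> (\<forall>v\<in>W. act ?X v = 0 \<longrightarrow> v = 0)"
      using v by blast
    then obtain m where m: "\<forall>v\<in>W. (u ^^ (2 * m)) v = 0"
      using dichotomy[of ?X] by (auto simp: act_X_power u_power_even)
    then obtain k where k: "\<forall>v\<in>W. (u ^^ k) v = 0" "\<And>m. m < k \<Longrightarrow> \<not> (\<forall>v\<in>W. (u ^^ m) v = 0)"
      using exists_least_iff[of "\<lambda>n. \<forall>v\<in>W. (u ^^ n) v = 0"] by blast
    have "k \<noteq> 0"
      using k(1) x0 by (intro notI) auto
    then obtain j where j: "k = Suc j"
      using not0_implies_Suc by blast
    then obtain x where x: "x \<in> W" "(u ^^ j) x \<noteq> 0"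
      using k(2)[of j] by auto
    show ?thesis
    proof (cases "even j")
      case True
      then obtain e where "j = 2 * e"
        by blast
      then show ?thesis
        using k(1) j x by (intro polarized_summand_bicyclic[OF W(1-3), of e x])
          (auto simp: u_power_even)
    next
      case False
      then obtain e where e: "j = Suc (2 * e)"
        by (auto elim: oddE)
      then have "k = 2 * Suc e"
        using j by simp
      then have 1: "act (?X ^ Suc e) v = 0" if "v \<in> W" for v
        using k(1) that by (simp only: u_power_even act_X_power)
      have 2: "v = 0" if "r \<noteq> 0" "degree r < degree ?X" "act r v = 0" for r v
      proof -
        obtain c where "r = [:c:]"
          using \<open>degree r < degree ?X\<close> by (auto elim: degree_eq_zeroE)
        then show ?thesis
          using that by (simp add: poly_map_const[OF endo_w])
      qed
      have 3: "u (act (?X ^ e) x) \<noteq> 0"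
        using x(2) by (simp add: e act_X_power u_power_even)
      show ?thesis
        by (rule polarized_summand_cyclic[OF W(1-3) _ 1 x(1) 3 2]) auto
    qed
  qed
qed

text \<open>
  An orthogonal splitting of \<open>W\<close> into two nonzero stable parts reduces the claim to smaller dimension.
  Without one, a polarized summand of \<open>W\<close> has to be all of \<open>W\<close>.
\<close>

lemma polarization_exists:
  assumes "subspace W" "u ` W \<subseteq> W" "nondeg W"
  shows "\<exists>L L'. polarized W L L'"
  using assms
proof (induction "dim W" arbitrary: W rule: less_induct)
  case less
  note W = less.prems
  have split: "\<exists>L L'. polarized W L L'"
    if ST: "W = S + T" "orthogonal S T" and S: "subspace S" "u ` S \<subseteq> S" "S \<noteq> {0}"
      and T: "subspace T" "u ` T \<subseteq> T" "T \<noteq> {0}" for S T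
  proof -
    have sub: "S \<subseteq> W" "T \<subseteq> W"
      using subset_sum_left[OF T(1), of S] subset_sum_right[OF S(1), of T] ST(1) by auto
    have TS: "W = T + S" "orthogonal T S"
      using ST orthogonal_sym by (auto simp: add.commute)
    have nd: "nondeg S" "nondeg T"
      using nondeg_summand[OF W(3) ST T(1)] nondeg_summand[OF W(3) TS S(1)] .
    have "S \<inter> T = {0}"
      using ST(2) nd(1) subspace_0[OF S(1)] subspace_0[OF T(1)]
        orthogonal_sym[OF ST(2)] by (auto simp: nondeg_def orthogonal_def)
    then have "S \<subset> W" "T \<subset> W"
      using sub S(3) T(3) by blast+
    then have dims: "dim S < dim W" "dim T < dim W"
      using subspace_dim_equal[OF S(1) W(1)] subspace_dim_equal[OF T(1) W(1)]
      by (metis linorder_not_less psubset_eq, metis linorder_not_less psubset_eq)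
    obtain L L' where "polarized S L L'"
      using less.hyps[OF dims(1) S(1,2) nd(1)] by blast
    moreover obtain M M' where "polarized T M M'"
      using less.hyps[OF dims(2) T(1,2) nd(2)] by blast
    ultimately show ?thesis
      using polarized_plus ST by blast
  qed
  show ?case
  proof (rule ccontr)
    assume contra: "\<not> ?case"
    have "polarized {0} {0} {0}"
      by (auto simp: polarized_def orthogonal_def u_simps set_plus_def)
    then have "W \<noteq> {0}"
      using contra by blast
    \<comment> \<open>Otherwise the Fitting decomposition of \<open>f(w)\<close> would split \<open>W\<close> properly.\<close>
    have "(\<forall>v\<in>W. act f v = 0 \<longrightarrow> v = 0) \<or> (\<exists>n. \<forall>v\<in>W. act (f ^ n) v = 0)" for f
    proof (rule ccontr)
      assume f: "\<not> ?thesis"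
      obtain n where "n \<noteq> 0" and n: "W = {v \<in> W. act (f ^ n) v = 0} + act (f ^ n) ` W"
        using fitting_decomposition[OF W(1,2)] .
      let ?S = "{v \<in> W. act (f ^ n) v = 0}" and ?T = "act (f ^ n) ` W"
      obtain v0 where v0: "v0 \<in> W" "act f v0 = 0" "v0 \<noteq> 0"
        using f by blast
      have "act (f ^ n) v0 = 0"
        using v0(2) \<open>n \<noteq> 0\<close> endo_0[OF endo_act] 
        by (cases n) (auto simp: poly_map_mult[OF endo_w] power_Suc2 simp del: power_Suc)
      then have "?S \<noteq> {0}"
        using v0 by blast
      moreover have "?T \<noteq> {0}"
        using f by blast
      moreover have "subspace ?S"
        using W(1) by (auto simp: subspace_def endo_add[OF endo_act] endo_scale[OF endo_act] endo_0[OF endo_act])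
      moreover have "u ` ?S \<subseteq> ?S" "u ` ?T \<subseteq> ?T"
        using W(2) u_simps(3) by (simp_all add: image_subset_iff u_act[symmetric]) (simp add: u_act)
      moreover have "orthogonal ?S ?T"
        by (auto simp: orthogonal_def simp flip: b_act)
      ultimately show False
        using contra split[OF n] subspace_endo_image[OF endo_act W(1)] by blast
    qed
    then obtain C L L' where C: "C \<subseteq> W" "C \<noteq> {0}" "nondeg C" "polarized C L L'"
      using polarized_summand_exists[OF W \<open>W \<noteq> {0}\<close>] unfolding has_polarized_summand_def by blast
    let ?D = "perp C \<inter> W"
    have subC: "subspace C" "u ` C \<subseteq> C"
      using C(4) polarized_subspace polarized_closed by auto
    have D: "subspace ?D" "orthogonal C ?D"
      using subspace_perp W(1) by (auto simp: subspace_inter orthogonal_def perp_def)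
    have "b z (u v) = 0" if "v \<in> perp C" "z \<in> C" for v z
      using b_u[of z v] that subC(2) by (auto simp: perp_def)
    then have uD: "u ` ?D \<subseteq> ?D"
      using W(2) by (auto simp: perp_def)
    have "W \<subseteq> C + ?D"
    proof
      fix v assume v: "v \<in> W"
      obtain c d where cd: "c \<in> C" "d \<in> perp C" "v = c + d"
        using nondeg_complement[OF subC(1) C(3)] by (metis UNIV_I set_plus_elim)
      then have "d = v - c"
        by simp
      then have "d \<in> W"
        using v cd(1) C(1) subspace_diff[OF W(1)] by blast
      then show "v \<in> C + ?D"
        using cd by (auto intro: set_plus_intro)
    qed
    moreover have "C + ?D \<subseteq> W"
      using C(1) subspace_add[OF W(1)] by (auto simp: set_plus_def)
    ultimately have eq: "W = C + ?D"
      by blast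
    show False
    proof (cases "?D = {0}")
      case True
      then have "W = C"
        using eq by (simp add: set_plus_def)
      then show False
        using C(4) contra by blast
    next
      case False
      then show False
        using split[OF eq D(2) subC C(2) D(1) uD] contra by blast
    qed
  qed
qed

text \<open>
  Writing \<open>\<pi>\<close> for the projection onto \<open>L\<close> along \<open>L'\<close>, isotropy reduces both \<open>b (u (\<pi> x)) y\<close> and
  \<open>b x (u (\<pi> y))\<close> to values on \<open>\<pi> x\<close> and \<open>\<pi> y\<close>, where skewness of \<open>u\<close> applies.
\<close>

lemma square_zero_summands:
  assumes pol: "polarized UNIV L L'" and nd: "nondeg UNIV"
  shows "\<exists>a1 a2. skew_selfadjoint scale b a1 \<and> skew_selfadjoint scale b a2 \<and>
           a1 \<circ> a1 = (\<lambda>x. 0) \<and> a2 \<circ> a2 = (\<lambda>x. 0) \<and> u = (\<lambda>x. a1 x + a2 x)"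
proof -
  have sub: "subspace L" "subspace L'" and iso: "isotropic L" "isotropic L'"
    and swap: "u ` L \<subseteq> L'" "u ` L' \<subseteq> L" and sum: "UNIV = L + L'"
    using pol by (auto simp: polarized_def)
  have "z = 0" if "z \<in> L" "z \<in> L'" for z
  proof -
    have "b z v = 0" for v
    proof -
      obtain x y where "x \<in> L" "y \<in> L'" "v = x + y"
        using sum by (metis UNIV_I set_plus_elim)
      then show ?thesis
        using iso that by (simp add: orthogonal_def b_add_right)
    qed
    then show ?thesis
      using nd by (auto simp: nondeg_def)
  qed
  then have unique: "x = x'" if "x \<in> L" "x' \<in> L" "v - x \<in> L'" "v - x' \<in> L'" for v x x'
  proof -
    have "x - x' \<in> L" "x - x' \<in> L'"
      using that sub subspace_diff[OF sub(2) that(4,3)] by (auto intro: subspace_diff)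
    then show ?thesis
      using \<open>\<And>z. z \<in> L \<Longrightarrow> z \<in> L' \<Longrightarrow> z = 0\<close> by fastforce
  qed
  have "\<exists>x\<in>L. v - x \<in> L'" for v
    using sum by (metis UNIV_I set_plus_elim add_diff_cancel_left')
  then obtain \<pi> where \<pi>: "\<And>v. \<pi> v \<in> L" "\<And>v. v - \<pi> v \<in> L'"
    by metis
  have \<pi>_eqI: "\<pi> v = x" if "x \<in> L" "v - x \<in> L'" for v x
    using unique \<pi> that by blast
  have \<pi>_add: "\<pi> (x + y) = \<pi> x + \<pi> y" for x y
    using \<pi> subspace_add[OF sub(1)] subspace_add[OF sub(2) \<pi>(2)[of x] \<pi>(2)[of y]]
    by (intro \<pi>_eqI) (auto simp: algebra_simps)
  have \<pi>_scale: "\<pi> (scale c x) = scale c (\<pi> x)" for c x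
    using \<pi> subspace_scale[OF sub(1)] subspace_scale[OF sub(2) \<pi>(2)[of x]]
    by (intro \<pi>_eqI) (auto simp: scale_right_diff_distrib)
  have \<pi>_L: "\<pi> x = x" if "x \<in> L" for x
    using that subspace_0[OF sub(2)] by (intro \<pi>_eqI) auto
  have \<pi>_L': "\<pi> y = 0" if "y \<in> L'" for y
    using that subspace_0[OF sub(1)] by (intro \<pi>_eqI) auto
  define a1 where "a1 v = u (\<pi> v)" for v
  define a2 where "a2 v = u (v - \<pi> v)" for v
  have "endo a1" "endo a2"
    by (auto simp: endo_iff a1_def a2_def \<pi>_add \<pi>_scale u_simps scale_right_diff_distrib algebra_simps)
  moreover have skew1: "b (a1 x) y = - b x (a1 y)" for x y
  proof -
    have "a1 v \<in> L'" for v
      using \<pi>(1) swap(1) by (auto simp: a1_def)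
    then have "b (a1 x) (y - \<pi> y) = 0" "b (x - \<pi> x) (a1 y) = 0"
      using \<pi>(2) iso(2) by (simp_all add: orthogonal_def)
    then have "b (a1 x) y = b (a1 x) (\<pi> y)" "b x (a1 y) = b (\<pi> x) (a1 y)"
      by (simp_all add: b_diff_right b_diff_left)
    then show ?thesis
      by (simp add: a1_def b_u)
  qed
  moreover have sum_a: "u v = a1 v + a2 v" for v
    by (simp add: a1_def a2_def u_simps)
  moreover have "b (a2 x) y = - b x (a2 y)" for x y
  proof -
    have "a2 v = u v - a1 v" for v
      by (simp add: sum_a)
    then show ?thesis
      by (simp add: b_diff_left b_diff_right b_u skew1)
  qed
  moreover have "a1 (a1 v) = 0" "a2 (a2 v) = 0" for v
  proof -
    have "a1 v \<in> L'" "a2 v \<in> L"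
      using \<pi> swap by (auto simp: a1_def a2_def)
    then show "a1 (a1 v) = 0" "a2 (a2 v) = 0"
      by (simp_all add: a1_def[of "a1 v"] a2_def[of "a2 v"] \<pi>_L \<pi>_L' u_simps)
  qed
  ultimately show ?thesis
    by (intro exI[of _ a1] exI[of _ a2]) (auto simp: skew_selfadjoint_def fun_eq_iff)
qed

end

section \<open>Sums of two square-zero skew-selfadjoint endomorphisms\<close>

theorem theorem1p7:
  fixes scale :: "'f::field \<Rightarrow> 'v::ab_group_add \<Rightarrow> 'v"
    and Basis :: "'v set"
    and b :: "'v \<Rightarrow> 'v \<Rightarrow> 'f"
    and u :: "'v \<Rightarrow> 'v"
  assumes "CHAR('f) \<noteq> 2"
    and "finite_dimensional_vector_space scale Basis"
    and "symplectic_form scale b"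
    and "skew_selfadjoint scale b u"
  shows "\<exists>a1 a2. skew_selfadjoint scale b a1 \<and> skew_selfadjoint scale b a2 \<and>
           a1 \<circ> a1 = (\<lambda>x. 0) \<and> a2 \<circ> a2 = (\<lambda>x. 0) \<and>
           u = (\<lambda>x. a1 x + a2 x)"
proof -
  have "(2::'f) \<noteq> 0"
  proof
    assume "(2::'f) = 0"
    then have "CHAR('f) dvd 2"
      using of_nat_eq_0_iff_char_dvd[of 2, where ?'a = 'f] by simp
    then have "CHAR('f) = 1"
      using assms(1) two_is_prime_nat by (auto simp: prime_nat_iff)
    then show False
      using of_nat_CHAR[where ?'a = 'f] by simp
  qed
  then interpret skew_endomorphism scale Basis b u
    using assms(2-4)
    by (simp add: skew_endomorphism_def fin_dim_space_def skew_endomorphism_axioms_def symplectic_form_def)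
  have nd: "nondeg UNIV"
    using assms(3) by (auto simp: nondeg_def symplectic_form_def nondegenerate_form_def)
  then obtain L L' where "polarized UNIV L L'"
    using polarization_exists[of UNIV] by auto
  then show ?thesis
    using nd by (rule square_zero_summands)
qed

end
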